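(* Let $N\ge2$, $M\ge N+1$ an integer and $\alpha\in(0,\infty)^{N+1}$. The continuous-time Markov chain on $\Delta^{(N)}_M$ generated by $\mathscr A^{(N)}_{M,\alpha}$ is irreducible and reversible with respect to $\mu^{(N)}_{M,\alpha}$. Moreover, $\mathscr A^{(N)}_{M,\alpha}$ has spectral gap $\alpha_{N+1}$ in $L^2(\mu^{(N)}_{M,\alpha})$.
   Context: $\Delta^{(N)}_M=\{x\in\frac1M\mathbb Z_+^N:|x|_1=\sum_{i=1}^Nx_i\le1\}$, $e_i$ the $i$-th standard unit vector. The generator is $$\mathscr A^{(N)}_{M,\alpha}f(x)=M\sum_{i=1}^N\Big\{\alpha_{N+1}x_i\big[f(x-\tfrac{e_i}M)-f(x)\big]+\alpha_i(1-|x|_1)\big[f(x+\tfrac{e_i}M)-f(x)\big]\Big\}+M^2\sum_{i=1}^N(1-|x|_1)x_i\Big\{f(x-\tfrac{e_i}M)+f(x+\tfrac{e_i}M)-2f(x)\Big\},$$ i.e. jump rates $q_{x,x-e_i/M}=Mx_i\alpha_{N+1}+M^2x_i(1-|x|_1)$, $q_{x,x+e_i/M}=\alpha_iM(1-|x|_1)+M^2x_i(1-|x|_1)$, and $0$ otherwise. The measure is $$\mu^{(N)}_{M,\alpha}(x)=\frac{[\alpha_{N+1}]_{M(1-|x|_1)}}{Z\,\{M(1-|x|_1)\}!}\prod_{i=1}^N\frac{[\alpha_i]_{Mx_i}}{(Mx_i)!},\qquad x\in\Delta^{(N)}_M,$$ with $[a]_m=\prod_{i=0}^{m-1}(a+i)$,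 $[a]_0=1$, and $Z$ the normalizing constant. The spectral gap is $\inf\{\mathcal E(f,f):\mu(f)=0,\mu(f^2)=1\}$ with $\mathcal E(f,f)=-\mu(f\,\mathscr A^{(N)}_{M,\alpha}f)$, $\mu=\mu^{(N)}_{M,\alpha}$. *)

theory Defs
  imports Complex_Main
begin

text \<open>Points x of the simplex are functions nat => real, with coordinates x 1, ..., x N
  and x i = 0 for i outside {1..N}.  The parameter alpha is indexed by 1..N+1.\<close>

definition simplex :: "nat \<Rightarrow> nat \<Rightarrow> (nat \<Rightarrow> real) set" where
  "simplex N M = {x. (\<forall>i. \<exists>k::nat. x i = real k / real M)
                   \<and> (\<forall>i. i \<notin> {1..N} \<longrightarrow> x i = 0)
                   \<and> (\<Sum>i=1..N. x i) \<le> 1}"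

definition norm1 :: "nat \<Rightarrow> (nat \<Rightarrow> real) \<Rightarrow> real" where
  "norm1 N x = (\<Sum>i=1..N. x i)"

text \<open>The generator applied to f at x (literal transcription of the formula).\<close>
definition gen :: "nat \<Rightarrow> nat \<Rightarrow> (nat \<Rightarrow> real) \<Rightarrow> ((nat \<Rightarrow> real) \<Rightarrow> real) \<Rightarrow> (nat \<Rightarrow> real) \<Rightarrow> real" where
  "gen N M \<alpha> f x =
     real M * (\<Sum>i=1..N.
        \<alpha> (N+1) * x i * (f (x(i := x i - 1 / real M)) - f x)
      + \<alpha> i * (1 - norm1 N x) * (f (x(i := x i + 1 / real M)) - f x))
   + (real M)^2 * (\<Sum>i=1..N. (1 - norm1 N x) * x i *
        (f (x(i := x i - 1 / real M)) + f (x(i := x i + 1 / real M)) - 2 * f x))"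

text \<open>Jump rates q(x,y) of the chain (for y \<noteq> x; the entries with y = x play no role).\<close>
definition rate :: "nat \<Rightarrow> nat \<Rightarrow> (nat \<Rightarrow> real) \<Rightarrow> (nat \<Rightarrow> real) \<Rightarrow> (nat \<Rightarrow> real) \<Rightarrow> real" where
  "rate N M \<alpha> x y = (\<Sum>i=1..N.
      (if y = x(i := x i - 1 / real M)
       then real M * x i * \<alpha> (N+1) + (real M)^2 * x i * (1 - norm1 N x) else 0)
    + (if y = x(i := x i + 1 / real M)
       then \<alpha> i * real M * (1 - norm1 N x) + (real M)^2 * x i * (1 - norm1 N x) else 0))"

text \<open>M r as a natural number (for x in the simplex, M x_i and M(1-|x|_1) are naturals).\<close>
definition cnt :: "nat \<Rightarrow> real \<Rightarrow> nat" where
  "cnt M r = nat (round (real M * r))"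

definition weight :: "nat \<Rightarrow> nat \<Rightarrow> (nat \<Rightarrow> real) \<Rightarrow> (nat \<Rightarrow> real) \<Rightarrow> real" where
  "weight N M \<alpha> x =
     pochhammer (\<alpha> (N+1)) (cnt M (1 - norm1 N x)) / fact (cnt M (1 - norm1 N x))
     * (\<Prod>i=1..N. pochhammer (\<alpha> i) (cnt M (x i)) / fact (cnt M (x i)))"

definition mu :: "nat \<Rightarrow> nat \<Rightarrow> (nat \<Rightarrow> real) \<Rightarrow> (nat \<Rightarrow> real) \<Rightarrow> real" where
  "mu N M \<alpha> x = weight N M \<alpha> x / (\<Sum>y\<in>simplex N M. weight N M \<alpha> y)"

definition expect :: "nat \<Rightarrow> nat \<Rightarrow> (nat \<Rightarrow> real) \<Rightarrow> ((nat \<Rightarrow> real) \<Rightarrow> real) \<Rightarrow> real" where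
  "expect N M \<alpha> f = (\<Sum>x\<in>simplex N M. mu N M \<alpha> x * f x)"

definition dirichlet :: "nat \<Rightarrow> nat \<Rightarrow> (nat \<Rightarrow> real) \<Rightarrow> ((nat \<Rightarrow> real) \<Rightarrow> real) \<Rightarrow> real" where
  "dirichlet N M \<alpha> f = - expect N M \<alpha> (\<lambda>x. f x * gen N M \<alpha> f x)"

definition spectral_gap :: "nat \<Rightarrow> nat \<Rightarrow> (nat \<Rightarrow> real) \<Rightarrow> real" where
  "spectral_gap N M \<alpha> = Inf {dirichlet N M \<alpha> f | f.
      expect N M \<alpha> f = 0 \<and> expect N M \<alpha> (\<lambda>x. (f x)^2) = 1}"

definition transitions :: "nat \<Rightarrow> nat \<Rightarrow> (nat \<Rightarrow> real) \<Rightarrow> ((nat \<Rightarrow> real) \<times> (nat \<Rightarrow> real)) set" where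
  "transitions N M \<alpha> = {(x, y). x \<in> simplex N M \<and> y \<in> simplex N M \<and> x \<noteq> y \<and> rate N M \<alpha> x y > 0}"

definition irreducible :: "nat \<Rightarrow> nat \<Rightarrow> (nat \<Rightarrow> real) \<Rightarrow> bool" where
  "irreducible N M \<alpha> = (\<forall>x\<in>simplex N M. \<forall>y\<in>simplex N M. (x, y) \<in> (transitions N M \<alpha>)\<^sup>*)"

definition reversible :: "nat \<Rightarrow> nat \<Rightarrow> (nat \<Rightarrow> real) \<Rightarrow> bool" where
  "reversible N M \<alpha> = (\<forall>x\<in>simplex N M. \<forall>y\<in>simplex N M.
      mu N M \<alpha> x * rate N M \<alpha> x y = mu N M \<alpha> y * rate N M \<alpha> y x)"

end

theory Submission
  imports Defs
begin

text \<open>In the coordinates \<open>n\<^sub>i = M x\<^sub>i\<close> and \<open>n\<^sub>c = M (1 - |x|\<^sub>1)\<close> the chain is the inclusion process of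
  \<open>M\<close> particles on the star graph with center \<open>c\<close>: a particle jumps from \<open>i\<close> to \<open>c\<close> at rate
  \<open>n\<^sub>i (\<alpha>\<^sub>c + n\<^sub>c)\<close> and from \<open>c\<close> to \<open>i\<close> at rate \<open>n\<^sub>c (\<alpha>\<^sub>i + n\<^sub>i)\<close>.  Its generator \<open>L\<close> commutes with
  the creation operator \<open>J\<^sup>*\<close> that adds a particle. The adjoint \<open>J\<close> satisfies
  \<open>J J\<^sup>* = (|\<alpha>| + 2 M) + J\<^sup>* J\<close>.  On the kernel of \<open>J\<close> a pointwise estimate gives
  \<open>-\<langle>h, L h\<rangle> \<ge> \<alpha>\<^sub>c M \<parallel>h\<parallel>\<^sup>2\<close>.  Splitting a mean-zero \<open>f = h + J\<^sup>* g\<close> orthogonally with \<open>J h = 0\<close>, and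
  writing \<open>D = L + \<alpha>\<^sub>c\<close>, the commutation relations turn \<open>\<langle>J\<^sup>* g, D J\<^sup>* g\<rangle>\<close> into a positive multiple
  of \<open>\<langle>g, D g\<rangle>\<close> plus \<open>\<langle>J g, D J g\<rangle>\<close>, so the gap inequality follows by induction from the systems
  with one and two particles fewer.  The bound is attained at \<open>x\<^sub>1/\<alpha>\<^sub>1 - x\<^sub>2/\<alpha>\<^sub>2\<close>.\<close>

section \<open>The inclusion process on a star graph\<close>

text \<open>Gram-Schmidt on \<open>T\<close>. The condition \<open>null\<close> replaces
  definiteness, because the form used later ignores values outside a finite set of configurations;
  \<open>v\<close> may also be linearly dependent.\<close>

lemma orthogonal_projection_exists:
  fixes B :: "('a \<Rightarrow> real) \<Rightarrow> ('a \<Rightarrow> real) \<Rightarrow> real" and v :: "'b \<Rightarrow> 'a \<Rightarrow> real"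
  assumes lin: "\<And>f g h t. B (\<lambda>x. f x - t * g x) h = B f h - t * B g h"
    and sym: "\<And>f g. B f g = B g f"
    and null: "\<And>f g. B f f = 0 \<Longrightarrow> B f g = 0"
    and "finite T"
  shows "\<exists>a. \<forall>j\<in>T. B (\<lambda>x. f x - (\<Sum>k\<in>T. a k * v k x)) (v j) = 0"
  using \<open>finite T\<close>
proof (induction T arbitrary: f rule: finite_induct)
  case empty
  then show ?case by simp
next
  case (insert j T)
  obtain a where a: "\<And>i. i \<in> T \<Longrightarrow> B (\<lambda>x. f x - (\<Sum>k\<in>T. a k * v k x)) (v i) = 0"
    using insert.IH by metis
  obtain b where b: "\<And>i. i \<in> T \<Longrightarrow> B (\<lambda>x. v j x - (\<Sum>k\<in>T. b k * v k x)) (v i) = 0"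
    using insert.IH by metis
  define p where "p = (\<lambda>x. f x - (\<Sum>k\<in>T. a k * v k x))"
  define u where "u = (\<lambda>x. v j x - (\<Sum>k\<in>T. b k * v k x))"
  \<comment> \<open>If \<open>B u u = 0\<close>, division by zero gives \<open>t = 0\<close>; this
    is harmless because \<open>null\<close> then forces \<open>B p u = 0\<close>.\<close>
  define t where "t = B p u / B u u"
  define a' where "a' = (\<lambda>k. if k = j then t else a k - t * b k)"
  have lin2: "B h (\<lambda>x. f x - t * g x) = B h f - t * B h g" for f g h t
    using lin sym by metis
  have sum0: "B h (\<lambda>x. g x - (\<Sum>k\<in>T'. d k * v k x)) = B h g"
    if "finite T'" "\<And>i. i \<in> T' \<Longrightarrow> B h (v i) = 0" for h g d T'
    using that
  proof (induction T' arbitrary: g rule: finite_induct)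
    case (insert i T')
    have "(\<lambda>x. g x - (\<Sum>k\<in>insert i T'. d k * v k x))
        = (\<lambda>x. (g x - d i * v i x) - (\<Sum>k\<in>T'. d k * v k x))"
      using insert.hyps by (simp add: algebra_simps)
    then have "B h (\<lambda>x. g x - (\<Sum>k\<in>insert i T'. d k * v k x)) = B h (\<lambda>x. g x - d i * v i x)"
      using insert.IH[of "\<lambda>x. g x - d i * v i x"] insert.prems by simp
    then show ?case
      using insert.prems by (simp add: lin2)
  qed simp
  have pT: "B p (v i) = 0" and uT: "B u (v i) = 0" if "i \<in> T" for i
    using a b that by (auto simp: p_def u_def)
  have uj: "B u (v j) = B u u"
    using sum0[OF \<open>finite T\<close> uT] by (simp add: u_def)
  have pj: "B p (v j) = B p u"
    using sum0[OF \<open>finite T\<close> pT, of "v j" b] by (simp add: u_def)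
  have res: "(\<lambda>x. f x - (\<Sum>k\<in>insert j T. a' k * v k x)) = (\<lambda>x. p x - t * u x)"
  proof
    fix x
    have "(\<Sum>k\<in>T. a' k * v k x) = (\<Sum>k\<in>T. a k * v k x) - t * (\<Sum>k\<in>T. b k * v k x)"
      unfolding sum_distrib_left sum_subtractf[symmetric]
      using insert.hyps by (intro sum.cong) (auto simp: a'_def algebra_simps)
    then show "f x - (\<Sum>k\<in>insert j T. a' k * v k x) = p x - t * u x"
      using insert.hyps by (simp add: a'_def p_def u_def algebra_simps)
  qed
  have "B u u = 0 \<Longrightarrow> B p u = 0"
    using null sym by metis
  have "B (\<lambda>x. p x - t * u x) (v i) = 0" if "i \<in> insert j T" for i
  proof (cases "i = j")
    case True
    then show ?thesis
      using \<open>B u u = 0 \<Longrightarrow> B p u = 0\<close> by (simp only: lin pj uj) (simp add: t_def)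
  next
    case False
    then show ?thesis
      using that pT uT by (simp only: lin) simp
  qed
  then show ?case
    unfolding res[symmetric] by blast
qed

section \<open>Configurations, weights and operators\<close>

locale star_inclusion =
  fixes I :: "'a set" and c :: 'a and \<alpha> :: "'a \<Rightarrow> real"
  assumes finite_leaves: "finite I" and center_notin: "c \<notin> I"
    and alpha_pos: "i \<in> insert c I \<Longrightarrow> \<alpha> i > 0"
begin

abbreviation sites :: "'a set" where "sites \<equiv> insert c I"

definition configs :: "nat \<Rightarrow> ('a \<Rightarrow> nat) set" where
  "configs M = {n. (\<forall>i. i \<notin> sites \<longrightarrow> n i = 0) \<and> (\<Sum>i\<in>sites. n i) = M}"

text \<open>Unnormalised Dirichlet-multinomial weights.\<close>

definition w :: "('a \<Rightarrow> nat) \<Rightarrow> real" where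
  "w n = (\<Prod>i\<in>sites. pochhammer (\<alpha> i) (n i) / fact (n i))"

definition inner :: "nat \<Rightarrow> (('a \<Rightarrow> nat) \<Rightarrow> real) \<Rightarrow> (('a \<Rightarrow> nat) \<Rightarrow> real) \<Rightarrow> real" where
  "inner M f g = (\<Sum>n\<in>configs M. w n * f n * g n)"

text \<open>The two jumps along one edge. Truncated subtraction at an empty site is harmless, since
  the jump has rate 0 there; the same holds in \<open>create\<close>.\<close>

definition Lsite :: "'a \<Rightarrow> (('a \<Rightarrow> nat) \<Rightarrow> real) \<Rightarrow> ('a \<Rightarrow> nat) \<Rightarrow> real" where
  "Lsite i f n =
     real (n i) * (\<alpha> c + real (n c)) * (f (n(i := n i - 1, c := n c + 1)) - f n)
   + real (n c) * (\<alpha> i + real (n i)) * (f (n(i := n i + 1, c := n c - 1)) - f n)"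

definition L :: "(('a \<Rightarrow> nat) \<Rightarrow> real) \<Rightarrow> ('a \<Rightarrow> nat) \<Rightarrow> real" where
  "L f n = (\<Sum>i\<in>I. Lsite i f n)"

definition create :: "(('a \<Rightarrow> nat) \<Rightarrow> real) \<Rightarrow> ('a \<Rightarrow> nat) \<Rightarrow> real" where
  "create g n = (\<Sum>i\<in>sites. real (n i) * g (n(i := n i - 1)))"

definition annih :: "(('a \<Rightarrow> nat) \<Rightarrow> real) \<Rightarrow> ('a \<Rightarrow> nat) \<Rightarrow> real" where
  "annih f n = (\<Sum>i\<in>sites. (\<alpha> i + real (n i)) * f (n(i := n i + 1)))"

lemma finite_sites: "finite sites"
  using finite_leaves by simp

lemma finite_configs: "finite (configs M)"
proof -
  have "configs M \<subseteq> {n. \<forall>i. (i \<in> sites \<longrightarrow> n i \<in> {..M}) \<and> (i \<notin> sites \<longrightarrow> n i = 0)}"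
    using member_le_sum[OF _ _ finite_sites] by (fastforce simp: configs_def)
  then show ?thesis
    by (rule finite_subset) (rule finite_set_of_finite_funs[OF finite_sites finite_atMost])
qed

lemma w_pos: "w n > 0"
  unfolding w_def using alpha_pos by (intro prod_pos divide_pos_pos) (auto intro!: pochhammer_pos)

text \<open>Only the factor at \<open>i\<close> changes. This ratio is the source of both the
  adjointness of creation and annihilation and detailed balance.\<close>

lemma w_Suc:
  assumes "i \<in> sites"
  shows "w (n(i := n i + 1)) * real (n i + 1) = w n * (\<alpha> i + real (n i))"
proof -
  let ?r = "\<lambda>n. \<Prod>j\<in>sites - {i}. pochhammer (\<alpha> j) (n j) / fact (n j)"
  have split: "w n = pochhammer (\<alpha> i) (n i) / fact (n i) * ?r n" for n
    unfolding w_def by (rule prod.remove[OF finite_sites assms])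
  have "?r (n(i := n i + 1)) = ?r n"
    by (rule prod.cong) auto
  then show ?thesis
    unfolding split[of n] split[of "n(i := n i + 1)"]
    by (simp add: pochhammer_Suc divide_simps)
qed

lemma configs_add: "n \<in> configs M \<Longrightarrow> i \<in> sites \<Longrightarrow> n(i := n i + 1) \<in> configs (Suc M)"
  unfolding configs_def
  using sum.remove[OF finite_sites, of i n] sum.remove[OF finite_sites, of i "n(i := n i + 1)"]
    sum.cong[of "sites - {i}" "sites - {i}" n "n(i := n i + 1)"]
  by auto

lemma configs_del: "n \<in> configs (Suc M) \<Longrightarrow> i \<in> sites \<Longrightarrow> n i > 0 \<Longrightarrow> n(i := n i - 1) \<in> configs M"
  unfolding configs_def
  using sum.remove[OF finite_sites, of i n] sum.remove[OF finite_sites, of i "n(i := n i - 1)"]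
    sum.cong[of "sites - {i}" "sites - {i}" n "n(i := n i - 1)"]
  by auto

text \<open>Terms with \<open>i\<close> empty vanish. On the others, removing a particle at
  \<open>i\<close> is a bijection onto \<open>configs M\<close>, and \<open>w_Suc\<close> converts
  the weights.\<close>

lemma sum_configs_Suc:
  assumes i: "i \<in> sites"
  shows "(\<Sum>n\<in>configs (Suc M). w n * real (n i) * F n)
       = (\<Sum>n\<in>configs M. w n * (\<alpha> i + real (n i)) * F (n(i := n i + 1)))"
proof -
  have "(\<Sum>n\<in>configs (Suc M). w n * real (n i) * F n)
      = (\<Sum>n\<in>{n\<in>configs (Suc M). n i > 0}. w n * real (n i) * F n)"
    by (rule sum.mono_neutral_right) (auto simp: finite_configs)
  also have "\<dots> = (\<Sum>n\<in>configs M. w n * (\<alpha> i + real (n i)) * F (n(i := n i + 1)))"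
  proof (rule sum.reindex_bij_witness[where i = "\<lambda>n. n(i := n i + 1)" and j = "\<lambda>n. n(i := n i - 1)"])
    fix n assume "n \<in> {n\<in>configs (Suc M). n i > 0}"
    then have n: "n \<in> configs (Suc M)" "n i > 0" by auto
    show "n(i := n i - 1) \<in> configs M" using configs_del[OF n(1) i n(2)] .
    have *: "(n(i := n i - 1))(i := (n(i := n i - 1)) i + 1) = n" using n(2) by auto
    then show "(n(i := n i - 1))(i := (n(i := n i - 1)) i + 1) = n" .
    show "w (n(i := n i - 1)) * (\<alpha> i + real ((n(i := n i - 1)) i)) *
        F ((n(i := n i - 1))(i := (n(i := n i - 1)) i + 1)) = w n * real (n i) * F n"
      using w_Suc[OF i, of "n(i := n i - 1)"] n(2) unfolding * by simp
  qed (use configs_add[OF _ i] in auto)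
  finally show ?thesis .
qed

lemma inner_sym: "inner M f g = inner M g f"
  unfolding inner_def by (simp add: mult_ac)

lemma inner_diff_left: "inner M (\<lambda>x. f x - t * g x) h = inner M f h - t * inner M g h"
  unfolding inner_def by (simp add: algebra_simps sum_subtractf sum_distrib_left)

lemma inner_add_left: "inner M (\<lambda>x. f x + g x) h = inner M f h + inner M g h"
  unfolding inner_def by (simp add: algebra_simps sum.distrib)

lemma inner_add_right: "inner M h (\<lambda>x. f x + g x) = inner M h f + inner M h g"
  unfolding inner_def by (simp add: algebra_simps sum.distrib)

lemma inner_scale_right: "inner M h (\<lambda>x. t * f x) = t * inner M h f"
  unfolding inner_def by (simp add: algebra_simps sum_distrib_left)

lemma inner_scale_left: "inner M (\<lambda>x. t * f x) h = t * inner M f h"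
  unfolding inner_def by (simp add: algebra_simps sum_distrib_left)

lemma inner_cong:
  "(\<And>n. n \<in> configs M \<Longrightarrow> f n = f' n) \<Longrightarrow> (\<And>n. n \<in> configs M \<Longrightarrow> g n = g' n) \<Longrightarrow> inner M f g = inner M f' g'"
  unfolding inner_def by (rule sum.cong) auto

lemma inner_self_nonneg: "inner M f f \<ge> 0"
  unfolding inner_def using w_pos
  by (intro sum_nonneg) (simp add: mult.assoc less_imp_le)

lemma inner_self_eq_0_iff: "inner M f f = 0 \<longleftrightarrow> (\<forall>n\<in>configs M. f n = 0)"
proof -
  have "inner M f f = 0 \<longleftrightarrow> (\<forall>n\<in>configs M. w n * f n * f n = 0)"
    unfolding inner_def using w_pos
    by (intro sum_nonneg_eq_0_iff) (auto simp: finite_configs mult.assoc less_imp_le)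
  then show ?thesis
    using w_pos by (auto simp: less_imp_neq[THEN not_sym])
qed

section \<open>Commutation relations\<close>

lemma inner_create: "inner (Suc M) (create g) f = inner M g (annih f)"
proof -
  have "inner (Suc M) (create g) f
      = (\<Sum>i\<in>sites. \<Sum>n\<in>configs (Suc M). w n * real (n i) * (g (n(i := n i - 1)) * f n))"
    unfolding inner_def create_def sum_distrib_left sum_distrib_right
    by (subst sum.swap) (simp add: mult_ac)
  also have "\<dots> = (\<Sum>i\<in>sites. \<Sum>n\<in>configs M. w n * (\<alpha> i + real (n i)) * (g n * f (n(i := n i + 1))))"
    by (rule sum.cong[OF refl], subst sum_configs_Suc) auto
  also have "\<dots> = inner M g (annih f)"
    unfolding inner_def annih_def sum_distrib_left sum_distrib_right
    by (subst sum.swap) (simp add: mult_ac)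
  finally show ?thesis .
qed

text \<open>Adding at \<open>i\<close> and removing at \<open>k\<close> commute for distinct sites.
  On the diagonal, \<open>(\<alpha> i + n i) * (n i + 1) - n i * (\<alpha> i + n i - 1)\<close>
  leaves \<open>\<alpha> i + 2 * n i\<close>, to be summed over the sites.\<close>

lemma annih_create:
  assumes "n \<in> configs M"
  shows "annih (create g) n = (sum \<alpha> sites + 2 * real M) * g n + create (annih g) n"
proof -
  let ?T = "\<lambda>i k. (\<alpha> i + real (n i)) * (real ((n(i := n i + 1)) k)
      * g ((n(i := n i + 1))(k := (n(i := n i + 1)) k - 1)))"
  let ?U = "\<lambda>i k. real (n k) * ((\<alpha> i + real ((n(k := n k - 1)) i))
      * g ((n(k := n k - 1))(i := (n(k := n k - 1)) i + 1)))"
  have eq: "?T i k = ?U i k + (if k = i then (\<alpha> i + 2 * real (n i)) * g n else 0)" for i k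
  proof (cases "k = i")
    case True
    then show ?thesis
      by (cases "n i") (simp_all add: fun_upd_idem algebra_simps)
  next
    case False
    then show ?thesis by (simp add: fun_upd_twist)
  qed
  have "annih (create g) n = (\<Sum>i\<in>sites. \<Sum>k\<in>sites. ?T i k)"
    unfolding annih_def create_def sum_distrib_left by simp
  also have "\<dots> = (\<Sum>i\<in>sites. \<Sum>k\<in>sites. ?U i k)
      + (\<Sum>i\<in>sites. \<Sum>k\<in>sites. if k = i then (\<alpha> i + 2 * real (n i)) * g n else 0)"
    unfolding eq sum.distrib ..
  also have "(\<Sum>i\<in>sites. \<Sum>k\<in>sites. if k = i then (\<alpha> i + 2 * real (n i)) * g n else 0)
      = (\<Sum>i\<in>sites. (\<alpha> i + 2 * real (n i)) * g n)"
    using finite_sites by (intro sum.cong) (auto simp: sum.delta)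
  also have "\<dots> = (sum \<alpha> sites + 2 * real (sum n sites)) * g n"
    by (simp only: sum_distrib_right[symmetric] sum.distrib sum_distrib_left[symmetric] of_nat_sum)
  also have "sum n sites = M"
    using assms by (simp add: configs_def)
  also have "(\<Sum>i\<in>sites. \<Sum>k\<in>sites. ?U i k) = create (annih g) n"
    unfolding annih_def create_def sum_distrib_left by (rule sum.swap)
  finally show ?thesis by simp
qed

text \<open>Commutation holds edge by edge. Writing the occupation numbers of the edge as
  \<open>a\<close> and \<open>b\<close> reduces it to an identity on two sites.\<close>

lemma Lsite_create:
  assumes i: "i \<in> I"
  shows "Lsite i (create g) n = create (Lsite i g) n"
proof -
  have ic: "i \<noteq> c" using i center_notin by auto
  define R where "R = sites - {i, c}"
  have split: "(\<Sum>k\<in>sites. F k) = F i + F c + (\<Sum>k\<in>R. F k)" for F :: "'a \<Rightarrow> real"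
  proof -
    have "(\<Sum>k\<in>sites. F k) = (\<Sum>k\<in>{i, c}. F k) + (\<Sum>k\<in>R. F k)"
      unfolding R_def using i finite_leaves by (subst sum.subset_diff[of "{i,c}"]) auto
    then show ?thesis using ic by simp
  qed
  define G where "G = (\<lambda>a b. g (n(i := a, c := b)))"
  \<comment> \<open>\<open>H\<close> collects the removals away from \<open>i\<close> and
    \<open>c\<close>. These leave \<open>a\<close> and \<open>b\<close> alone, so they commute with
    the edge operator \<open>?K a b\<close>.\<close>
  define H where "H = (\<lambda>a b. \<Sum>k\<in>R. real (n k) * g (n(i := a, c := b, k := n k - 1)))"
  have cr: "create g (n(i := a, c := b)) = real a * G (a - 1) b + real b * G a (b - 1) + H a b" for a b
  proof -
    have "(\<Sum>k\<in>R. real ((n(i := a, c := b)) k) * g ((n(i := a, c := b))(k := (n(i := a, c := b)) k - 1)))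
      = H a b"
      unfolding H_def R_def by (rule sum.cong) auto
    moreover have "n(i := a, c := b, i := a - 1) = n(i := a - 1, c := b)"
      using ic by (simp add: fun_upd_twist)
    ultimately show ?thesis
      unfolding create_def split G_def using ic by simp
  qed
  let ?K = "\<lambda>a b. \<lambda>F :: nat \<Rightarrow> nat \<Rightarrow> real. real a * (\<alpha> c + real b) * (F (a - 1) (b + 1) - F a b)
    + real b * (\<alpha> i + real a) * (F (a + 1) (b - 1) - F a b)"
  have id: "n(i := n i, c := n c) = n" by simp
  have L1: "Lsite i F (m(i := a, c := b)) = ?K a b (\<lambda>a b. F (m(i := a, c := b)))" for F m a b
  proof -
    have "m(i := a, c := b, i := a', c := b') = m(i := a', c := b')" for a' b'
      using ic by (simp add: fun_upd_twist)
    then show ?thesis unfolding Lsite_def using ic by simp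
  qed
  define a where "a = n i"
  define b where "b = n c"
  have n: "n = n(i := a, c := b)" by (simp add: a_def b_def)
  have lhs: "Lsite i (create g) n
      = ?K a b (\<lambda>a b. real a * G (a - 1) b + real b * G a (b - 1)) + ?K a b H"
    by (subst n, subst L1) (simp only: cr algebra_simps)
  have "(\<Sum>k\<in>R. real (n k) * Lsite i g (n(k := n k - 1))) = ?K a b H"
  proof -
    have "Lsite i g (n(k := n k - 1)) = ?K a b (\<lambda>a b. g (n(i := a, c := b, k := n k - 1)))"
      if "k \<in> R" for k
    proof -
      have ki: "k \<noteq> i" "k \<noteq> c" using that by (auto simp: R_def)
      then have upd: "n(k := n k - 1, i := a', c := b') = n(i := a', c := b', k := n k - 1)" for a' b'
        by (auto simp: fun_eq_iff)
      have "n(k := n k - 1, i := a, c := b) = n(k := n k - 1)"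
        using ki by (auto simp: fun_eq_iff a_def b_def)
      then show ?thesis using L1[of g "n(k := n k - 1)" a b] by (simp only: upd)
    qed
    then have "(\<Sum>k\<in>R. real (n k) * Lsite i g (n(k := n k - 1)))
        = (\<Sum>k\<in>R. real (n k) * ?K a b (\<lambda>a b. g (n(i := a, c := b, k := n k - 1))))"
      by (intro sum.cong) auto
    also have "\<dots> = ?K a b H"
      unfolding H_def by (simp add: sum_subtractf sum.distrib sum_distrib_left algebra_simps)
    finally show ?thesis .
  qed
  moreover have "n(i := n i - 1) = n(i := a - 1, c := b)" "n(c := n c - 1) = n(i := a, c := b - 1)"
    using ic by (auto simp: fun_eq_iff a_def b_def)
  then have "Lsite i g (n(i := n i - 1)) = ?K (a - 1) b G"
    "Lsite i g (n(c := n c - 1)) = ?K a (b - 1) G"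
    unfolding G_def by (simp_all only: L1)
  ultimately have rhs: "create (Lsite i g) n
      = real a * ?K (a - 1) b G + real b * ?K a (b - 1) G + ?K a b H"
    unfolding create_def split by (simp only: a_def b_def)
  \<comment> \<open>The commutation on the two sites alone, a polynomial identity; the case split
    resolves the truncated subtractions.\<close>
  have "?K a b (\<lambda>a b. real a * G (a - 1) b + real b * G a (b - 1))
      = real a * ?K (a - 1) b G + real b * ?K a (b - 1) G"
    by (cases a; cases b) (simp_all add: algebra_simps)
  then show ?thesis using lhs rhs by simp
qed

lemma L_create: "L (create g) n = create (L g) n"
proof -
  have "L (create g) n = (\<Sum>i\<in>I. create (Lsite i g) n)"
    unfolding L_def by (simp add: Lsite_create)
  also have "\<dots> = create (L g) n"
    unfolding create_def L_def sum_distrib_left by (rule sum.swap)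
  finally show ?thesis .
qed

section \<open>Dirichlet form\<close>

text \<open>Each jump moves one particle between \<open>i\<close> and \<open>c\<close> over a
  background \<open>n\<close> of \<open>M\<close> particles. Shifting both sums to the background
  pairs the two directions. The symmetry of \<open>L\<close> and the estimate on the kernel of
  \<open>annih\<close> are read off from this form.\<close>

lemma inner_L_Suc:
  "inner (Suc M) f (L g) = - (\<Sum>n\<in>configs M. w n * (\<alpha> c + real (n c)) *
     (\<Sum>i\<in>I. (\<alpha> i + real (n i)) * ((f (n(i := n i + 1)) - f (n(c := n c + 1)))
        * (g (n(i := n i + 1)) - g (n(c := n c + 1))))))"
proof -
  have *: "(\<Sum>n\<in>configs (Suc M). w n * f n * Lsite i g n) =
    - (\<Sum>n\<in>configs M. w n * (\<alpha> c + real (n c)) *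
     ((\<alpha> i + real (n i)) * ((f (n(i := n i + 1)) - f (n(c := n c + 1)))
        * (g (n(i := n i + 1)) - g (n(c := n c + 1))))))" (is "?l = - ?r") if i: "i \<in> I" for i
  proof -
    have ic: "i \<noteq> c" using i center_notin by auto
    have "?l = (\<Sum>n\<in>configs (Suc M). w n * real (n i) *
            (f n * ((\<alpha> c + real (n c)) * (g (n(i := n i - 1, c := n c + 1)) - g n))))
        + (\<Sum>n\<in>configs (Suc M). w n * real (n c) *
            (f n * ((\<alpha> i + real (n i)) * (g (n(i := n i + 1, c := n c - 1)) - g n))))"
      unfolding Lsite_def sum.distrib[symmetric] by (simp add: algebra_simps)
    also have "\<dots> = (\<Sum>n\<in>configs M. w n * (\<alpha> i + real (n i)) *
            (f (n(i := n i + 1)) * ((\<alpha> c + real (n c)) * (g (n(c := n c + 1)) - g (n(i := n i + 1))))))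
        + (\<Sum>n\<in>configs M. w n * (\<alpha> c + real (n c)) *
            (f (n(c := n c + 1)) * ((\<alpha> i + real (n i)) * (g (n(i := n i + 1)) - g (n(c := n c + 1))))))"
      using i ic by (subst (1 2) sum_configs_Suc) (auto simp: fun_upd_twist)
    also have "\<dots> = - ?r"
      unfolding sum.distrib[symmetric] sum_negf[symmetric]
      by (intro sum.cong) (simp_all add: algebra_simps)
    finally show ?thesis .
  qed
  have "inner (Suc M) f (L g) = (\<Sum>i\<in>I. \<Sum>n\<in>configs (Suc M). w n * f n * Lsite i g n)"
    unfolding inner_def L_def sum_distrib_left by (rule sum.swap)
  also have "\<dots> = (\<Sum>i\<in>I. - (\<Sum>n\<in>configs M. w n * (\<alpha> c + real (n c)) *
     ((\<alpha> i + real (n i)) * ((f (n(i := n i + 1)) - f (n(c := n c + 1)))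
        * (g (n(i := n i + 1)) - g (n(c := n c + 1)))))))"
    using * by (intro sum.cong) auto
  also have "\<dots> = - (\<Sum>n\<in>configs M. w n * (\<alpha> c + real (n c)) *
     (\<Sum>i\<in>I. (\<alpha> i + real (n i)) * ((f (n(i := n i + 1)) - f (n(c := n c + 1)))
        * (g (n(i := n i + 1)) - g (n(c := n c + 1))))))"
    unfolding sum_negf sum_distrib_left by (subst sum.swap) (rule refl)
  finally show ?thesis .
qed

lemma configs_0: "n \<in> configs 0 \<Longrightarrow> i \<in> sites \<Longrightarrow> n i = 0"
  using finite_sites by (auto simp: configs_def)

lemma L_sym: "inner M f (L g) = inner M (L f) g"
proof (cases M)
  case 0
  have "L f n = 0" if "n \<in> configs 0" for f n
    using configs_0[OF that] unfolding L_def Lsite_def by (intro sum.neutral) auto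
  then show ?thesis
    unfolding inner_def 0 by simp
next
  case (Suc m)
  show ?thesis
    unfolding Suc inner_sym[of _ "L f"] inner_L_Suc by (simp add: mult_ac)
qed

lemma L_add_scaled: "L (\<lambda>n. f n + t * g n) n = L f n + t * L g n"
  unfolding L_def Lsite_def sum_distrib_left sum.distrib[symmetric]
  by (intro sum.cong) (auto simp: algebra_simps)

text \<open>The estimate on the kernel of annihilation: given \<open>\<eta>\<close> with one particle fewer, the values
  \<open>f (\<eta> + \<delta>\<^sub>i)\<close> have weighted mean zero, so replacing \<open>f\<close> by \<open>f - f (\<eta> + \<delta>\<^sub>c)\<close> can only increase
  the weighted sum of squares.\<close>
lemma gap_annih_0:
  assumes "\<And>n. n \<in> configs M \<Longrightarrow> annih f n = 0"
  shows "inner (Suc M) f (L f) \<le> - \<alpha> c * real (Suc M) * inner (Suc M) f f"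
proof -
  \<comment> \<open>The particle number is the sum of the \<open>n i\<close>, so each summand can be
    shifted to a background with one particle fewer.\<close>
  have "real (Suc M) * inner (Suc M) f f = inner (Suc M) f (\<lambda>n. real (Suc M) * f n)"
    by (simp add: inner_scale_right)
  also have "\<dots> = (\<Sum>n\<in>configs (Suc M). \<Sum>i\<in>sites. w n * real (n i) * (f n)\<^sup>2)"
    unfolding inner_def
  proof (rule sum.cong)
    fix n assume "n \<in> configs (Suc M)"
    then have "real (Suc M) = (\<Sum>i\<in>sites. real (n i))"
      unfolding configs_def using of_nat_sum[of n sites, where 'a = real] by simp
    then show "w n * f n * (real (Suc M) * f n) = (\<Sum>i\<in>sites. w n * real (n i) * (f n)\<^sup>2)"
      by (simp only: sum_distrib_right sum_distrib_left power2_eq_square mult_ac)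
  qed simp
  also have "\<dots> = (\<Sum>n\<in>configs M. \<Sum>i\<in>sites. w n * (\<alpha> i + real (n i)) * (f (n(i := n i + 1)))\<^sup>2)"
    by (subst (1 2) sum.swap, rule sum.cong[OF refl], rule sum_configs_Suc)
  also have "\<alpha> c * \<dots> \<le> (\<Sum>n\<in>configs M. w n * (\<alpha> c + real (n c)) *
     (\<Sum>i\<in>I. (\<alpha> i + real (n i)) * (f (n(i := n i + 1)) - f (n(c := n c + 1)))\<^sup>2))"
    unfolding sum_distrib_left[of "\<alpha> c" _ "configs M"]
  proof (rule sum_mono)
    fix n assume n: "n \<in> configs M"
    let ?p = "\<lambda>i. \<alpha> i + real (n i)" and ?f = "\<lambda>i. f (n(i := n i + 1))"
    have p: "?p i > 0" if "i \<in> sites" for i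
      using alpha_pos[OF that] by simp
    have "(\<Sum>i\<in>I. ?p i * (?f i - ?f c)\<^sup>2) = (\<Sum>i\<in>sites. ?p i * (?f i - ?f c)\<^sup>2)"
      using finite_leaves center_notin by simp
    also have "\<dots> = (\<Sum>i\<in>sites. ?p i * (?f i)\<^sup>2) - 2 * ?f c * (\<Sum>i\<in>sites. ?p i * ?f i)
        + (\<Sum>i\<in>sites. ?p i) * (?f c)\<^sup>2"
      unfolding sum_distrib_left sum_distrib_right sum_subtractf[symmetric] sum.distrib[symmetric]
      by (rule sum.cong) (simp_all only: power2_diff algebra_simps)
    \<comment> \<open>The cross term is zero by the hypothesis on \<open>annih f\<close>, and the
      last term is nonnegative.\<close>
    also have "\<dots> \<ge> (\<Sum>i\<in>sites. ?p i * (?f i)\<^sup>2)"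
      using assms[OF n] sum_nonneg[of sites ?p] p
      unfolding annih_def by (simp add: less_imp_le del: sum.insert)
    finally have "(\<Sum>i\<in>sites. ?p i * (?f i)\<^sup>2) \<le> (\<Sum>i\<in>I. ?p i * (?f i - ?f c)\<^sup>2)" .
    moreover have "0 \<le> (\<Sum>i\<in>I. ?p i * (?f i - ?f c)\<^sup>2)"
      using p by (intro sum_nonneg) (simp add: less_imp_le)
    \<comment> \<open>Here the occupation of the center is dropped: \<open>?p c\<close> is at least
      \<open>\<alpha> c\<close>.\<close>
    ultimately have "\<alpha> c * (\<Sum>i\<in>sites. ?p i * (?f i)\<^sup>2) \<le> ?p c * (\<Sum>i\<in>I. ?p i * (?f i - ?f c)\<^sup>2)"
      using alpha_pos[of c] by (intro order_trans[OF mult_left_mono mult_right_mono]) auto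
    then have "w n * (\<alpha> c * (\<Sum>i\<in>sites. ?p i * (?f i)\<^sup>2))
        \<le> w n * (?p c * (\<Sum>i\<in>I. ?p i * (?f i - ?f c)\<^sup>2))"
      using w_pos[of n] by (intro mult_left_mono) auto
    moreover have "w n * (\<alpha> c * (\<Sum>i\<in>sites. ?p i * (?f i)\<^sup>2))
        = \<alpha> c * (\<Sum>i\<in>sites. w n * ?p i * (?f i)\<^sup>2)"
      by (simp only: sum_distrib_left mult_ac)
    ultimately show "\<alpha> c * (\<Sum>i\<in>sites. w n * ?p i * (?f i)\<^sup>2)
        \<le> w n * ?p c * (\<Sum>i\<in>I. ?p i * (?f i - ?f c)\<^sup>2)"
      by (simp only: mult.assoc)
  qed
  finally show ?thesis
    unfolding inner_L_Suc power2_eq_square by (simp add: mult_ac)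
qed

section \<open>Induction on the number of particles\<close>

text \<open>Project \<open>f\<close> onto the span of the created indicators. By adjointness,
  orthogonality of \<open>h\<close> to \<open>?v z\<close> says
  \<open>w z * annih h z = 0\<close>.\<close>

lemma create_decomposition:
  obtains h g where "\<And>n. f n = h n + create g n" "\<And>n. n \<in> configs M \<Longrightarrow> annih h n = 0"
proof -
  let ?v = "\<lambda>z. create (\<lambda>n. if n = z then 1 else 0)"
  have null: "inner (Suc M) u g = 0" if "inner (Suc M) u u = 0" for u g
    using that unfolding inner_self_eq_0_iff by (simp add: inner_def)
  have "\<exists>a. \<forall>z\<in>configs M. inner (Suc M) (\<lambda>n. f n - (\<Sum>z\<in>configs M. a z * ?v z n)) (?v z) = 0"
    by (rule orthogonal_projection_exists[where B = "inner (Suc M)" and f = f and v = ?v and T = "configs M",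
        OF inner_diff_left inner_sym _ finite_configs]) (rule null)
  then obtain a where a: "\<And>z. z \<in> configs M \<Longrightarrow>
      inner (Suc M) (\<lambda>n. f n - (\<Sum>z\<in>configs M. a z * ?v z n)) (?v z) = 0"
    by blast
  define h where "h = (\<lambda>n. f n - (\<Sum>z\<in>configs M. a z * ?v z n))"
  \<comment> \<open>Extending by zero makes \<open>create g\<close> equal to the projection at every
    \<open>n\<close>, not only on \<open>configs (Suc M)\<close>.\<close>
  define g where "g = (\<lambda>n. if n \<in> configs M then a n else 0)"
  have g: "g n = (\<Sum>z\<in>configs M. a z * (if n = z then 1 else 0))" for n
    unfolding g_def using finite_configs[of M] by (simp add: if_distrib cong: if_cong)
  have "create g n = (\<Sum>z\<in>configs M. a z * ?v z n)" for n
    unfolding create_def g sum_distrib_left by (subst sum.swap) (simp only: mult_ac)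
  then have "f n = h n + create g n" for n
    by (simp add: h_def)
  moreover have "annih h z = 0" if z: "z \<in> configs M" for z
  proof -
    have "0 = inner (Suc M) (?v z) h"
      using a[OF z, folded h_def] by (simp add: inner_sym[of _ h])
    also have "\<dots> = inner M (\<lambda>n. if n = z then 1 else 0) (annih h)"
      by (rule inner_create)
    also have "\<dots> = (\<Sum>n\<in>configs M. if n = z then w z * annih h z else 0)"
      unfolding inner_def by (rule sum.cong) auto
    also have "\<dots> = w z * annih h z"
      using finite_configs[of M] z by simp
    finally show ?thesis using w_pos[of z] by simp
  qed
  ultimately show thesis by (rule that)
qed

text \<open>The induction is strong because the step uses the claim for \<open>g\<close>, with one
  particle fewer, and for \<open>annih g\<close>, with two fewer.\<close>

lemma gap_inequality:
  assumes "inner M f (\<lambda>_. 1) = 0"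
  shows "inner M f (L f) \<le> - \<alpha> c * inner M f f"
  using assms
proof (induction M arbitrary: f rule: less_induct)
  case (less M)
  show ?case
  proof (cases M)
    case 0
    have "configs 0 = {\<lambda>_. 0}"
      using finite_sites by (auto simp: configs_def fun_eq_iff) metis
    then have "f n = 0" if "n \<in> configs 0" for n
      using less.prems that w_pos[of n] by (simp add: 0 inner_def)
    then show ?thesis
      by (simp add: 0 inner_def)
  next
    case (Suc m)
    obtain h g where f: "\<And>n. f n = h n + create g n"
      and h: "\<And>n. n \<in> configs m \<Longrightarrow> annih h n = 0"
      using create_decomposition[of f m] by blast
    define D where "D = (\<lambda>u n. L u n + \<alpha> c * u n)"
    have D_inner: "inner k u (D v) = inner k u (L v) + \<alpha> c * inner k u v" for k u v
      unfolding D_def by (simp only: inner_add_right inner_scale_right)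
    have D_sym: "inner k u (D v) = inner k v (D u)" for k u v
      unfolding D_inner using L_sym[of k u v] inner_sym[of k "L u" v] inner_sym[of k u v] by simp
    have D_create: "D (create u) n = create (D u) n" for u n
      unfolding D_def L_create create_def
      by (simp only: sum_distrib_left distrib_left sum.distrib mult_ac)
    have orth: "inner (Suc m) (create u) h = 0" for u
      using inner_create[of m u h] h by (simp add: inner_def[of m])
    have mean_create: "inner (Suc k) (create u) (\<lambda>_. 1) = (sum \<alpha> sites + real k) * inner k u (\<lambda>_. 1)" for k u
    proof -
      have "annih (\<lambda>_. 1) n = sum \<alpha> sites + real k" if "n \<in> configs k" for n
        using that of_nat_sum[of n sites, where 'a = real]
        by (simp add: annih_def configs_def sum.distrib del: sum.insert)
      then have "inner k u (annih (\<lambda>_. 1)) = inner k u (\<lambda>_. (sum \<alpha> sites + real k) * 1)"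
        by (intro inner_cong) auto
      then show ?thesis
        unfolding inner_create inner_scale_right .
    qed
    have create_1: "create (\<lambda>_. 1) n = real k" if "n \<in> configs k" for n k
      using that of_nat_sum[of n sites, where 'a = real]
      by (simp add: create_def configs_def del: sum.insert)
    have pos: "sum \<alpha> sites > 0"
      using alpha_pos finite_sites by (intro sum_pos) auto
    \<comment> \<open>Constants lie in the range of \<open>create\<close>, so \<open>h\<close> has
      mean zero. The positive factor in \<open>mean_create\<close> then passes the zero mean of
      \<open>f\<close> on to \<open>g\<close>.\<close>
    have "real (Suc m) * inner (Suc m) (\<lambda>_. 1) h = inner (Suc m) (create (\<lambda>_. 1)) h"
      unfolding inner_scale_left[symmetric] by (rule inner_cong) (auto simp: create_1)
    then have "inner (Suc m) h (\<lambda>_. 1) = 0"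
      unfolding orth by (simp add: inner_sym)
    moreover have "inner (Suc m) f (\<lambda>_. 1) = inner (Suc m) h (\<lambda>_. 1) + inner (Suc m) (create g) (\<lambda>_. 1)"
      unfolding inner_add_left[symmetric] by (rule inner_cong) (auto simp: f)
    ultimately have g_mean: "inner m g (\<lambda>_. 1) = 0"
      using less.prems pos unfolding Suc mean_create by simp
    have g_le: "inner m g (D g) \<le> 0"
      using less.IH[OF _ g_mean] by (simp add: Suc D_inner)
    have ca_le: "inner m (create (annih g)) (D g) \<le> 0"
    proof (cases m)
      case 0
      have "create u n = 0" if "n \<in> configs 0" for u n
        using configs_0[OF that] unfolding create_def by (intro sum.neutral) auto
      then show ?thesis
        unfolding inner_def 0 by simp
    next
      case (Suc k)
      \<comment> \<open>By adjointness the mean of \<open>annih g\<close> is the product of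
        \<open>g\<close> with \<open>create\<close> of 1, which is the constant
        \<open>m\<close>.\<close>
      have "real m * inner k (annih g) (\<lambda>_. 1) = 0"
      proof -
        have "inner k (annih g) (\<lambda>_. 1) = inner (Suc k) (create (\<lambda>_. 1)) g"
          unfolding inner_create by (rule inner_sym)
        also have "\<dots> = inner (Suc k) (\<lambda>_. real m * 1) g"
          by (rule inner_cong) (auto simp: create_1 Suc)
        also have "\<dots> = 0"
          unfolding inner_scale_left using g_mean by (simp add: Suc inner_sym)
        finally show ?thesis by simp
      qed
      then have "inner k (annih g) (D (annih g)) \<le> 0"
        using less.IH[of k "annih g"] by (simp add: Suc \<open>M = Suc m\<close> D_inner)
      moreover have "inner m (create (annih g)) (D g) = inner k (annih g) (D (annih g))"
      proof -
        have "inner m (create (annih g)) (D g) = inner m g (create (D (annih g)))"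
          unfolding D_sym[of m "create (annih g)"] by (rule inner_cong) (auto simp: D_create)
        also have "\<dots> = inner k (D (annih g)) (annih g)"
          by (subst inner_sym) (simp only: Suc inner_create)
        finally show ?thesis by (simp only: inner_sym)
      qed
      ultimately show ?thesis by simp
    qed
    \<comment> \<open>The kernel bound has the factor \<open>Suc m\<close>; the summand
      \<open>\<alpha> c\<close> in \<open>D\<close> uses up one unit of it.\<close>
    have "inner (Suc m) h (D h) \<le> - \<alpha> c * real m * inner (Suc m) h h"
      using gap_annih_0[of m h] h by (simp add: D_inner algebra_simps)
    also have "\<dots> \<le> 0"
      using alpha_pos[of c] inner_self_nonneg by (simp add: less_imp_le)
    finally have hh: "inner (Suc m) h (D h) \<le> 0" .
    \<comment> \<open>\<open>D\<close> preserves the range of \<open>create\<close>, to which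
      \<open>h\<close> is orthogonal, so the cross term vanishes.\<close>
    have "inner (Suc m) h (D (create g)) = inner (Suc m) (create (D g)) h"
      unfolding inner_sym[of _ h] by (rule inner_cong) (auto simp: D_create)
    then have hg: "inner (Suc m) h (D (create g)) = 0"
      by (simp add: orth)
    have "inner (Suc m) (create g) (D (create g)) = inner (Suc m) (create (D g)) (create g)"
      unfolding inner_sym[of _ "create g"] by (rule inner_cong) (auto simp: D_create)
    also have "\<dots> = inner m (D g) (\<lambda>n. (sum \<alpha> sites + 2 * real m) * g n + create (annih g) n)"
      unfolding inner_create by (rule inner_cong) (auto simp: annih_create simp del: sum.insert)
    also have "\<dots> = (sum \<alpha> sites + 2 * real m) * inner m g (D g) + inner m (create (annih g)) (D g)"
      by (simp only: inner_add_right inner_scale_right inner_sym)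
    also have "\<dots> \<le> 0"
      using g_le ca_le pos by (intro add_nonpos_nonpos mult_nonneg_nonpos) auto
    finally have gg: "inner (Suc m) (create g) (D (create g)) \<le> 0" .
    have "D f n = D h n + D (create g) n" for n
    proof -
      have "f = (\<lambda>n. h n + 1 * create g n)" using f by auto
      then have "L f n = L h n + 1 * L (create g) n" by (simp only: L_add_scaled)
      then show ?thesis unfolding D_def f by (simp add: algebra_simps)
    qed
    then have "inner (Suc m) f (D f) = inner (Suc m) h (D h) + inner (Suc m) h (D (create g))
        + (inner (Suc m) h (D (create g)) + inner (Suc m) (create g) (D (create g)))"
      using inner_cong[of "Suc m" f "\<lambda>n. h n + create g n" "D f" "\<lambda>n. D h n + D (create g) n"] f
      by (simp add: inner_add_left inner_add_right D_sym[of _ "create g" h])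
    then have "inner (Suc m) f (D f) \<le> 0"
      using hh hg gg by simp
    then show ?thesis
      by (simp add: Suc D_inner)
  qed
qed

section \<open>The extremal eigenfunction\<close>

text \<open>\<open>L\<close> maps \<open>n i\<close> to
  \<open>\<alpha> i * n c - \<alpha> c * n i\<close>. After division by \<open>\<alpha> i\<close>
  the center contributes the same \<open>n c\<close> for every leaf and cancels in a
  difference.\<close>

lemma L_eigenfunction:
  assumes "i \<in> I" "j \<in> I" "i \<noteq> j"
  shows "L (\<lambda>n. real (n i) / \<alpha> i - real (n j) / \<alpha> j) n
    = - \<alpha> c * (real (n i) / \<alpha> i - real (n j) / \<alpha> j)"
proof -
  have coord: "L (\<lambda>n. real (n i)) n = \<alpha> i * real (n c) - \<alpha> c * real (n i)" if "i \<in> I" for i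
  proof -
    have ic: "i \<noteq> c" using that center_notin by auto
    have "Lsite k (\<lambda>n. real (n i)) n = (if k = i then \<alpha> i * real (n c) - \<alpha> c * real (n i) else 0)" for k
      unfolding Lsite_def using ic by (cases "n i"; cases "k = i") (simp_all add: algebra_simps)
    then show ?thesis
      unfolding L_def using finite_leaves that by simp
  qed
  have "L (\<lambda>n. real (n i) / \<alpha> i - real (n j) / \<alpha> j) n
      = (L (\<lambda>n. real (n i)) n) / \<alpha> i - (L (\<lambda>n. real (n j)) n) / \<alpha> j"
    unfolding L_def Lsite_def sum_divide_distrib sum_subtractf[symmetric]
    by (intro sum.cong) (simp_all add: diff_divide_distrib add_divide_distrib algebra_simps)
  then show ?thesis
    using assms alpha_pos[of i] alpha_pos[of j] by (simp add: coord field_simps)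
qed

lemma inner_1_L: "inner M (\<lambda>_. 1) (L f) = 0"
  unfolding L_sym[of M "\<lambda>_. 1"] by (simp add: inner_def L_def Lsite_def)

end

section \<open>The chain on the simplex\<close>

lemma cnt_divide: "M > 0 \<Longrightarrow> cnt M (real k / real M) = k"
  by (simp add: cnt_def)

locale dirichlet_chain =
  fixes N M :: nat and \<alpha> :: "nat \<Rightarrow> real"
  assumes M_pos: "M > 0" and alpha_positive: "\<And>i. i \<in> {1..N+1} \<Longrightarrow> \<alpha> i > 0"
begin

sublocale star_inclusion "{1..N}" "N + 1" \<alpha>
  by standard (auto intro: alpha_positive)

text \<open>Otherwise the simplifier rewrites the locale parameters \<open>{1..N}\<close> and \<open>N + 1\<close> inside the
  inherited constants, and the inherited facts no longer match.\<close>
declare One_nat_def [simp del]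

text \<open>The site \<open>N + 1\<close> holds the \<open>M (1 - |x|\<^sub>1)\<close> particles missing from the coordinates of \<open>x\<close>.\<close>
definition point :: "(nat \<Rightarrow> nat) \<Rightarrow> nat \<Rightarrow> real" where
  "point n = (\<lambda>i. if i \<in> {1..N} then real (n i) / real M else 0)"

lemma configs_sum: "n \<in> configs M \<Longrightarrow> n (N+1) + (\<Sum>i=1..N. n i) = M"
  by (simp add: configs_def)

lemma norm1_point: "n \<in> configs M \<Longrightarrow> 1 - norm1 N (point n) = real (n (N+1)) / real M"
proof -
  assume n: "n \<in> configs M"
  have "norm1 N (point n) = real (\<Sum>i=1..N. n i) / real M"
    unfolding norm1_def point_def by (simp add: sum_divide_distrib)
  also have "real (\<Sum>i=1..N. n i) = real M - real (n (N+1))"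
    using configs_sum[OF n] by linarith
  finally show ?thesis
    using M_pos by (simp add: field_simps)
qed

lemma inj_point: "inj_on point (configs M)"
proof (rule inj_onI)
  fix n m assume n: "n \<in> configs M" and m: "m \<in> configs M" and eq: "point n = point m"
  have in_N: "n i = m i" if "i \<in> {1..N}" for i
    using fun_cong[OF eq, of i] that M_pos by (simp add: point_def)
  then have "n (N+1) = m (N+1)"
    using configs_sum[OF n] configs_sum[OF m] by simp
  then show "n = m"
    using in_N n m by (auto simp: configs_def fun_eq_iff) metis
qed

lemma point_image: "point ` configs M = simplex N M"
proof (intro equalityI subsetI)
  fix x assume "x \<in> point ` configs M"
  then obtain n where n: "n \<in> configs M" and x: "x = point n" by auto
  have "(\<Sum>i=1..N. x i) \<le> 1"
  proof -
    have "0 \<le> 1 - norm1 N (point n)"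
      unfolding norm1_point[OF n] by simp
    then show ?thesis by (simp add: x norm1_def)
  qed
  moreover have "\<exists>k::nat. x i = real k / real M" for i
    by (cases "i \<in> {1..N}") (auto simp: x point_def intro: exI[of _ "0::nat"])
  ultimately show "x \<in> simplex N M"
    by (auto simp: simplex_def x point_def)
next
  fix x assume x: "x \<in> simplex N M"
  then obtain k where k: "\<And>i. x i = real (k i) / real M"
    unfolding simplex_def by (auto dest!: choice)
  \<comment> \<open>The missing mass goes to the center; the subtraction is exact because the sum is
    shown below to be at most \<open>M\<close>.\<close>
  define n where "n = (\<lambda>i. if i \<in> {1..N} then k i else if i = N + 1 then M - (\<Sum>i=1..N. k i) else 0)"
  have "real (\<Sum>i=1..N. k i) / real M \<le> 1"
    using x by (simp add: simplex_def k sum_divide_distrib)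
  then have "(\<Sum>i=1..N. k i) \<le> M"
    using M_pos by (simp add: field_simps flip: of_nat_sum)
  moreover have "(\<Sum>i=1..N. n i) = (\<Sum>i=1..N. k i)"
    by (rule sum.cong) (auto simp: n_def)
  ultimately have "n \<in> configs M"
    by (auto simp: configs_def n_def)
  moreover have "x = point n"
    using x by (auto simp: fun_eq_iff point_def n_def k simplex_def)
  ultimately show "x \<in> point ` configs M" by blast
qed

lemma sum_simplex: "(\<Sum>x\<in>simplex N M. F x) = (\<Sum>n\<in>configs M. F (point n))"
  unfolding point_image[symmetric] by (simp add: sum.reindex[OF inj_point])

lemma weight_point: "n \<in> configs M \<Longrightarrow> weight N M \<alpha> (point n) = w n"
proof -
  assume n: "n \<in> configs M"
  have "(\<Prod>i=1..N. pochhammer (\<alpha> i) (cnt M (point n i)) / fact (cnt M (point n i)))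
      = (\<Prod>i=1..N. pochhammer (\<alpha> i) (n i) / fact (n i))"
    by (rule prod.cong) (auto simp: point_def cnt_divide[OF M_pos])
  then show ?thesis
    unfolding weight_def w_def norm1_point[OF n] cnt_divide[OF M_pos] by simp
qed

definition Z :: real where "Z = (\<Sum>n\<in>configs M. w n)"

text \<open>Corresponds to the origin. It witnesses that \<open>configs M\<close> is nonempty and
  serves as the hub for irreducibility.\<close>

definition start :: "nat \<Rightarrow> nat" where "start = (\<lambda>i. if i = N + 1 then M else 0)"

lemma start_configs: "start \<in> configs M"
  by (simp add: configs_def start_def)

lemma Z_pos: "Z > 0"
  unfolding Z_def using start_configs finite_configs w_pos by (intro sum_pos) auto

lemma mu_point: "n \<in> configs M \<Longrightarrow> mu N M \<alpha> (point n) = w n / Z"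
  unfolding mu_def sum_simplex Z_def by (simp add: weight_point)

lemma expect_eq: "expect N M \<alpha> f = (\<Sum>n\<in>configs M. w n * f (point n)) / Z"
  unfolding expect_def sum_simplex sum_divide_distrib by (rule sum.cong) (simp_all add: mu_point)

text \<open>Positivity of \<open>n i\<close> matters: at 0 the left side would have a negative
  coordinate, while truncated subtraction gives 0.\<close>

lemma point_down:
  assumes "i \<in> {1..N}" "n i > 0"
  shows "(point n)(i := point n i - 1 / real M) = point (n(i := n i - 1, N + 1 := n (N + 1) + 1))"
  using assms by (auto simp: point_def fun_eq_iff diff_divide_distrib)

text \<open>\<open>point\<close> does not look at the site \<open>N + 1\<close>, so truncated
  subtraction at an empty center changes nothing.\<close>

lemma point_up:
  assumes "i \<in> {1..N}"
  shows "(point n)(i := point n i + 1 / real M) = point (n(i := n i + 1, N + 1 := n (N + 1) - 1))"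
  using assms by (auto simp: point_def fun_eq_iff add_divide_distrib)

text \<open>In each direction the first- and second-order terms combine: the downward coefficients
  add up to \<open>n i * (\<alpha> (N+1) + n (N+1))\<close>, the upward ones to
  \<open>n (N+1) * (\<alpha> i + n i)\<close>.\<close>

lemma gen_point:
  assumes n: "n \<in> configs M"
  shows "gen N M \<alpha> f (point n) = L (\<lambda>n. f (point n)) n"
proof -
  have *: "real M * (\<alpha> (N+1) * point n i * (f ((point n)(i := point n i - 1 / real M)) - f (point n))
      + \<alpha> i * (real (n (N+1)) / real M) * (f ((point n)(i := point n i + 1 / real M)) - f (point n)))
    + (real M)\<^sup>2 * ((real (n (N+1)) / real M) * point n i *
        (f ((point n)(i := point n i - 1 / real M)) + f ((point n)(i := point n i + 1 / real M)) - 2 * f (point n)))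
    = Lsite i (\<lambda>n. f (point n)) n" (is "?l = _") if i: "i \<in> {1..N}" for i
  proof -
    define d where "d = f ((point n)(i := point n i - 1 / real M))"
    define u where "u = f ((point n)(i := point n i + 1 / real M))"
    define v where "v = f (point n)"
    have p: "point n i = real (n i) / real M" using i by (simp add: point_def)
    have "?l = real (n i) * (\<alpha> (N+1) + real (n (N+1))) * (d - v)
        + real (n (N+1)) * (\<alpha> i + real (n i)) * (u - v)"
      unfolding d_def[symmetric] u_def[symmetric] v_def[symmetric] unfolding p
      using M_pos by (simp add: power2_eq_square field_simps)
    moreover have "u = f (point (n(i := n i + 1, N + 1 := n (N + 1) - 1)))"
      unfolding u_def point_up[OF i] ..
    \<comment> \<open>For \<open>n i = 0\<close> the lower neighbour lies outside the simplex, but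
      its coefficient is zero.\<close>
    moreover have "n i > 0 \<Longrightarrow> d = f (point (n(i := n i - 1, N + 1 := n (N + 1) + 1)))"
      unfolding d_def by (subst point_down[OF i]) auto
    ultimately show ?thesis
      unfolding Lsite_def v_def by (cases "n i = 0") simp_all
  qed
  show ?thesis
    unfolding gen_def L_def norm1_point[OF n] sum_distrib_left sum.distrib[symmetric]
    by (rule sum.cong[OF refl]) (simp only: *[symmetric] distrib_left)
qed

section \<open>Spectral gap\<close>

lemma dirichlet_eq:
  "dirichlet N M \<alpha> f = - inner M (\<lambda>n. f (point n)) (L (\<lambda>n. f (point n))) / Z"
proof -
  have "(\<Sum>n\<in>configs M. w n * (f (point n) * gen N M \<alpha> f (point n)))
      = inner M (\<lambda>n. f (point n)) (L (\<lambda>n. f (point n)))"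
    unfolding inner_def by (rule sum.cong) (simp_all add: gen_point)
  then show ?thesis
    by (simp add: dirichlet_def expect_eq)
qed

lemma expect_square: "expect N M \<alpha> (\<lambda>x. (f x)\<^sup>2) = inner M (\<lambda>n. f (point n)) (\<lambda>n. f (point n)) / Z"
  unfolding expect_eq inner_def by (simp add: power2_eq_square mult.assoc)

lemma expect_mean: "expect N M \<alpha> f = inner M (\<lambda>n. f (point n)) (\<lambda>_. 1) / Z"
  unfolding expect_eq inner_def by simp

lemma spectral_gap_eq:
  assumes "N \<ge> 2"
  shows "spectral_gap N M \<alpha> = \<alpha> (N + 1)"
  unfolding spectral_gap_def
proof (rule cInf_eq_minimum)
  define F where "F = (\<lambda>n :: nat \<Rightarrow> nat. real (n 1) / \<alpha> 1 - real (n 2) / \<alpha> 2)"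
  \<comment> \<open>\<open>t\<close> normalises the second moment to 1; the factor
    \<open>real M\<close> in \<open>f\<close> undoes the division in \<open>point\<close>.\<close>
  define t where "t = sqrt (Z / inner M F F)"
  define f where "f = (\<lambda>x :: nat \<Rightarrow> real. t * (real M * (x 1 / \<alpha> 1 - x 2 / \<alpha> 2)))"
  have fp: "f (point n) = t * F n" for n
    using assms M_pos by (simp add: f_def F_def point_def field_simps)
  have LF: "L F n = - \<alpha> (N + 1) * F n" for n
    unfolding F_def using assms by (intro L_eigenfunction) auto
  have LtF: "L (\<lambda>n. t * F n) n = - \<alpha> (N + 1) * (t * F n)" for n
    using L_add_scaled[of "\<lambda>_. 0" t F n] by (simp add: LF L_def[of "\<lambda>_. 0"] Lsite_def)
  have "inner M F F \<noteq> 0"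
  proof -
    \<comment> \<open>All particles at site 1: a configuration where \<open>F\<close> does not
      vanish.\<close>
    define e where "e = (\<lambda>i::nat. if i = 1 then M else 0)"
    have "e \<in> configs M"
      using assms by (simp add: configs_def e_def)
    moreover have "F e \<noteq> 0"
      using M_pos alpha_positive[of 1] by (simp add: F_def e_def)
    ultimately show ?thesis
      unfolding inner_self_eq_0_iff by blast
  qed
  then have FF: "inner M F F > 0"
    using inner_self_nonneg[of M F] by simp
  \<comment> \<open>Symmetry moves \<open>L\<close> onto the constant, which it kills, so an
    eigenfunction with nonzero eigenvalue has mean zero.\<close>
  have "\<alpha> (N + 1) * inner M F (\<lambda>_. 1) = - inner M (\<lambda>_. 1) (\<lambda>n. - \<alpha> (N + 1) * F n)"
    unfolding inner_scale_right by (simp add: inner_sym)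
  also have "(\<lambda>n. - \<alpha> (N + 1) * F n) = L F"
    using LF by (simp add: fun_eq_iff)
  finally have "inner M F (\<lambda>_. 1) = 0"
    using alpha_positive[of "N + 1"] by (simp add: inner_1_L)
  then have "expect N M \<alpha> f = 0"
    unfolding expect_mean fp inner_scale_left by simp
  moreover have one: "expect N M \<alpha> (\<lambda>x. (f x)\<^sup>2) = 1"
    unfolding expect_square fp inner_scale_left inner_scale_right
    using FF Z_pos by (simp add: t_def flip: mult.assoc power2_eq_square)
  moreover have "dirichlet N M \<alpha> f = \<alpha> (N + 1)"
  proof -
    have "dirichlet N M \<alpha> f = \<alpha> (N + 1) * expect N M \<alpha> (\<lambda>x. (f x)\<^sup>2)"
      unfolding dirichlet_eq expect_square fp LtF[THEN ext] inner_scale_right[of M _ "- \<alpha> (N + 1)"] by simp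
    then show ?thesis unfolding one by simp
  qed
  ultimately show "\<alpha> (N + 1) \<in> {dirichlet N M \<alpha> f | f.
      expect N M \<alpha> f = 0 \<and> expect N M \<alpha> (\<lambda>x. (f x)\<^sup>2) = 1}"
    by force
next
  fix y assume "y \<in> {dirichlet N M \<alpha> f | f. expect N M \<alpha> f = 0 \<and> expect N M \<alpha> (\<lambda>x. (f x)\<^sup>2) = 1}"
  then obtain f where y: "y = dirichlet N M \<alpha> f" and mean: "expect N M \<alpha> f = 0"
    and norm: "expect N M \<alpha> (\<lambda>x. (f x)\<^sup>2) = 1" by blast
  have "inner M (\<lambda>n. f (point n)) (\<lambda>_. 1) = 0"
    using mean Z_pos unfolding expect_mean by simp
  moreover have "inner M (\<lambda>n. f (point n)) (\<lambda>n. f (point n)) = Z"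
    using norm Z_pos unfolding expect_square by simp
  ultimately show "\<alpha> (N + 1) \<le> y"
    using gap_inequality[of M "\<lambda>n. f (point n)"] Z_pos unfolding y dirichlet_eq
    by (simp add: field_simps)
qed

section \<open>Reversibility\<close>

lemma configs_move:
  assumes "n \<in> configs M" "i \<in> {1..N}" "n i > 0"
  shows "n(i := n i - 1, N + 1 := n (N + 1) + 1) \<in> configs M"
proof -
  obtain m where m: "M = Suc m" using M_pos by (cases M) auto
  have "n(i := n i - 1) \<in> configs m"
    using assms unfolding m by (intro configs_del) auto
  from configs_add[OF this, of "N + 1"] show ?thesis
    using assms(2) unfolding m by simp
qed

text \<open>With \<open>u\<close> the configuration without the moving particle, both sides of an
  actual jump equal \<open>w u * (\<alpha> i + u i) * (\<alpha> (N+1) + u (N+1))\<close>.\<close>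

lemma detailed_balance_step:
  assumes n: "n \<in> configs M" and m: "m \<in> configs M" and i: "i \<in> {1..N}"
  shows "w n * (if point m = (point n)(i := point n i - 1 / real M)
       then real M * point n i * \<alpha> (N+1) + (real M)\<^sup>2 * point n i * (1 - norm1 N (point n)) else 0)
     = w m * (if point n = (point m)(i := point m i + 1 / real M)
       then \<alpha> i * real M * (1 - norm1 N (point m)) + (real M)\<^sup>2 * point m i * (1 - norm1 N (point m)) else 0)"
    (is "w n * (if ?P then ?a else 0) = w m * (if ?Q then ?b else 0)")
proof -
  have PQ: "?P \<longleftrightarrow> ?Q" by (auto simp: fun_eq_iff)
  have p: "point k i = real (k i) / real M" for k using i by (simp add: point_def)
  show ?thesis
  proof (cases ?P)
    case True
    then have "point m i = point n i - 1 / real M" by simp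
    then have "n i > 0"
      using M_pos by (cases "n i") (simp_all add: p field_simps)
    then have m_eq: "m = n(i := n i - 1, N + 1 := n (N + 1) + 1)"
      using True inj_onD[OF inj_point _ m configs_move[OF n i]] by (simp only: point_down[OF i])
    define u where "u = n(i := n i - 1)"
    have iN: "i \<noteq> N + 1" using i by auto
    have nu: "n = u(i := u i + 1)" and mu: "m = u(N + 1 := u (N + 1) + 1)"
      using \<open>n i > 0\<close> iN by (auto simp: u_def m_eq)
    have wn: "w n * real (n i) = w u * (\<alpha> i + real (u i))"
      using w_Suc[of i u] i unfolding nu[symmetric] by (simp add: nu)
    have wm: "w m * real (m (N+1)) = w u * (\<alpha> (N+1) + real (u (N+1)))"
      using w_Suc[of "N+1" u] unfolding mu[symmetric] by (simp add: mu)
    have "?a = real (n i) * (\<alpha> (N+1) + real (n (N+1)))"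
      unfolding norm1_point[OF n] unfolding p using M_pos by (simp add: power2_eq_square field_simps)
    also have "n (N+1) = u (N+1)"
      using iN by (simp add: u_def)
    finally have "w n * ?a = w n * real (n i) * (\<alpha> (N+1) + real (u (N+1)))"
      by simp
    moreover have "?b = real (m (N+1)) * (\<alpha> i + real (m i))"
      unfolding norm1_point[OF m] unfolding p using M_pos by (simp add: power2_eq_square field_simps)
    then have "w m * ?b = w m * real (m (N+1)) * (\<alpha> i + real (m i))"
      by simp
    moreover have "m i = u i"
      using iN by (simp add: mu)
    ultimately have eq: "w n * ?a = w m * ?b"
      unfolding wn wm by (simp only: mult_ac)
    have ?Q using PQ True by blast
    show ?thesis
      unfolding if_P[OF True] if_P[OF \<open>?Q\<close>] by (rule eq)
  qed (simp add: PQ)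
qed

text \<open>In each coordinate the down term of one direction balances the up term of the
  other.\<close>

lemma reversible: "reversible N M \<alpha>"
  unfolding reversible_def point_image[symmetric]
proof (clarify)
  fix n m assume n: "n \<in> configs M" and m: "m \<in> configs M"
  have "w n * rate N M \<alpha> (point n) (point m) = w m * rate N M \<alpha> (point m) (point n)"
    unfolding rate_def sum_distrib_left
  proof (rule sum.cong[OF refl], unfold distrib_left)
    fix i assume i: "i \<in> {1..N}"
    show "w n * (if point m = (point n)(i := point n i - 1 / real M)
        then real M * point n i * \<alpha> (N+1) + (real M)\<^sup>2 * point n i * (1 - norm1 N (point n)) else 0)
      + w n * (if point m = (point n)(i := point n i + 1 / real M)
        then \<alpha> i * real M * (1 - norm1 N (point n)) + (real M)\<^sup>2 * point n i * (1 - norm1 N (point n)) else 0)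
      = w m * (if point n = (point m)(i := point m i - 1 / real M)
        then real M * point m i * \<alpha> (N+1) + (real M)\<^sup>2 * point m i * (1 - norm1 N (point m)) else 0)
      + w m * (if point n = (point m)(i := point m i + 1 / real M)
        then \<alpha> i * real M * (1 - norm1 N (point m)) + (real M)\<^sup>2 * point m i * (1 - norm1 N (point m)) else 0)"
      unfolding detailed_balance_step[OF n m i] detailed_balance_step[OF m n i] by (rule add.commute)
  qed
  then show "mu N M \<alpha> (point n) * rate N M \<alpha> (point n) (point m)
      = mu N M \<alpha> (point m) * rate N M \<alpha> (point m) (point n)"
    by (simp add: mu_point n m)
qed

section \<open>Irreducibility\<close>

text \<open>Detailed balance with positive \<open>mu\<close> makes the reverse rate positive, so it
  suffices to build paths towards a single state.\<close>

lemma sym_transitions: "sym (transitions N M \<alpha>)"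
proof (rule symI)
  fix x y assume xy: "(x, y) \<in> transitions N M \<alpha>"
  then have "mu N M \<alpha> x > 0" "mu N M \<alpha> y > 0"
    using w_pos Z_pos by (auto simp: transitions_def mu_point point_image[symmetric])
  moreover have "mu N M \<alpha> y * rate N M \<alpha> y x = mu N M \<alpha> x * rate N M \<alpha> x y"
    using xy reversible by (auto simp: reversible_def transitions_def)
  moreover have "rate N M \<alpha> x y > 0"
    using xy by (simp add: transitions_def)
  ultimately have "rate N M \<alpha> y x > 0"
    by (metis mult_pos_pos zero_less_mult_pos)
  then show "(y, x) \<in> transitions N M \<alpha>"
    using xy by (auto simp: transitions_def)
qed

lemma transition_down:
  assumes n: "n \<in> configs M" and i: "i \<in> {1..N}" and ni: "n i > 0"
  shows "(point n, point (n(i := n i - 1, N + 1 := n (N + 1) + 1))) \<in> transitions N M \<alpha>"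
proof -
  let ?x = "point n" and ?y = "(point n)(i := point n i - 1 / real M)"
  define d where "d = (\<lambda>j. real M * ?x j * \<alpha> (N+1) + (real M)\<^sup>2 * ?x j * (1 - norm1 N ?x))"
  define u where "u = (\<lambda>j. \<alpha> j * real M * (1 - norm1 N ?x) + (real M)\<^sup>2 * ?x j * (1 - norm1 N ?x))"
  have nonneg: "?x j \<ge> 0" "1 - norm1 N ?x \<ge> 0" for j
    unfolding norm1_point[OF n] by (simp_all add: point_def)
  have "?x i > 0"
    using i ni M_pos by (simp add: point_def)
  then have di: "d i > 0"
    unfolding d_def using nonneg M_pos alpha_positive[of "N+1"]
    by (intro add_pos_nonneg mult_pos_pos mult_nonneg_nonneg) auto
  have d: "d j \<ge> 0" and u: "u j \<ge> 0" if "j \<in> {1..N}" for j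
    unfolding d_def u_def using nonneg alpha_positive[of j] alpha_positive[of "N+1"] that
    by (auto intro!: add_nonneg_nonneg mult_nonneg_nonneg less_imp_le)
  have "rate N M \<alpha> ?x ?y = (\<Sum>j=1..N. (if ?y = ?x(j := ?x j - 1 / real M) then d j else 0)
      + (if ?y = ?x(j := ?x j + 1 / real M) then u j else 0))"
    unfolding rate_def d_def u_def ..
  also have "\<dots> > 0"
  \<comment> \<open>The rate sums over all coordinates; the summand for \<open>i\<close> is positive
    and the others are nonnegative.\<close>
  proof (rule sum_pos2[OF _ i])
    show "0 < (if ?y = ?y then d i else 0) + (if ?y = ?x(i := ?x i + 1 / real M) then u i else 0)"
      using di u[OF i] by (intro add_pos_nonneg) auto
  qed (use d u in \<open>auto intro!: add_nonneg_nonneg\<close>)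
  finally have "0 < rate N M \<alpha> ?x ?y" .
  moreover have "?x \<noteq> ?y"
    using M_pos by (auto simp: fun_eq_iff)
  moreover have "?x \<in> simplex N M" "?y \<in> simplex N M"
    using n configs_move[OF n i ni] unfolding point_image[symmetric] point_down[where n=n, OF i ni] by blast+
  ultimately show ?thesis
    unfolding transitions_def point_down[where n=n, OF i ni] by simp
qed

text \<open>Particles move to the center one at a time; the measure counts those still outside
  it.\<close>

lemma reaches_start:
  "n \<in> configs M \<Longrightarrow> (point n, point start) \<in> (transitions N M \<alpha>)\<^sup>*"
proof (induction "M - n (N+1)" arbitrary: n rule: less_induct)
  case less
  show ?case
  proof (cases "\<exists>i\<in>{1..N}. n i > 0")
    case True
    then obtain i where i: "i \<in> {1..N}" "n i > 0" by blast
    let ?m = "n(i := n i - 1, N + 1 := n (N + 1) + 1)"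
    have "n i \<le> (\<Sum>i=1..N. n i)"
      using i by (intro member_le_sum) auto
    then have "M - ?m (N+1) < M - n (N+1)"
      using i configs_sum[OF less.prems] by simp
    then have "(point ?m, point start) \<in> (transitions N M \<alpha>)\<^sup>*"
      using less.hyps configs_move[OF less.prems i] by blast
    then show ?thesis
      using transition_down[OF less.prems i] by (rule converse_rtrancl_into_rtrancl[rotated])
  next
    case False
    then have "point n = point start"
      by (auto simp: point_def start_def fun_eq_iff)
    then show ?thesis by simp
  qed
qed

lemma irreducible: "irreducible N M \<alpha>"
  unfolding irreducible_def point_image[symmetric]
proof clarify
  fix n m assume "n \<in> configs M" "m \<in> configs M"
  then have "(point n, point start) \<in> (transitions N M \<alpha>)\<^sup>*"
    "(point start, point m) \<in> (transitions N M \<alpha>)\<^sup>*"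
    using reaches_start symD[OF sym_rtrancl[OF sym_transitions]] by auto
  then show "(point n, point m) \<in> (transitions N M \<alpha>)\<^sup>*"
    by (rule rtrancl_trans)
qed

end

theorem theorem6p1:
  fixes N M :: nat and \<alpha> :: "nat \<Rightarrow> real"
  assumes "N \<ge> 2" and "M \<ge> N + 1" and "\<forall>i\<in>{1..N+1}. \<alpha> i > 0"
  shows "irreducible N M \<alpha> \<and> reversible N M \<alpha> \<and> spectral_gap N M \<alpha> = \<alpha> (N+1)"
proof -
  interpret dirichlet_chain N M \<alpha>
    by standard (use assms in auto)
  show ?thesis
    using irreducible reversible spectral_gap_eq[OF assms(1)] by simp
qed

end
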